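(* Let $f(\cdot;i):\mathbb{R}^d\to\mathbb{R}$, $i\in[n]$, and $F(w)=\frac1n\sum_{i=1}^n f(w;i)$. Assume: (a) $\mathrm{dom}(F)\neq\emptyset$ and $F_*:=\inf_{w\in\mathbb{R}^d}F(w)>-\infty$; (b) there is $L>0$ such that for every $i\in[n]$ and all $w,w'\in\mathrm{dom}(F)$, $\|\nabla f(w;i)-\nabla f(w';i)\|\le L\|w-w'\|$; (c) there are finite constants $\Theta,\sigma\ge 0$ such that for all $w\in\mathrm{dom}(F)$, $\frac1n\sum_{i=1}^n\|\nabla f(w;i)-\nabla F(w)\|^2\le\Theta\|\nabla F(w)\|^2+\sigma^2$. Let the iterates be generated by the SMG algorithm (described in the context) with a fixed momentum weight $0\le\beta<1$, learning rates $\eta_i^{(t)}=\frac{\eta_t}{n}$, and any choice of permutations $\pi^{(t)}$. Set $\eta_0:=\eta_1$ and assume $\eta_t\ge\eta_{t+1}$ and $0<\eta_t\le\frac{1}{L\sqrt K}$ for $t\ge1$, where $K:=\max\left\{\frac52,\frac{9(5-3\beta)(\Theta+1)}{1-\beta}\right\}$. Then, for every realization of the permutations, with $\mathbb{E}$ denoting expectation over the random choice of the output $\hat w_T$, $$\mathbb{E}\big[\|\nabla F(\hat w_T)\|^2\big]=\frac{1}{\sum_{t=1}^T\eta_t}\sum_{t=1}^T\eta_t\|\nabla F(\tilde w_{t-1})\|^2\le\frac{4[F(\tilde w_0)-F_*]}{(1-\beta)\sum_{t=1}^T\eta_t}+\frac{9\sigma^2L^2(5-3\beta)}{1-\beta}\left(\frac{\sum_{t=1}^T\eta_{t-1}^3}{\sum_{t=1}^T\eta_t}\right).$$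 In particular, the upper bound on $\mathbb{E}[\|\nabla F(\hat w_T)\|^2]$ also holds when the expectation is taken over all the randomness (of the permutations and of $\hat w_T$).
   Context: $[n]=\{1,\dots,n\}$; $\|\cdot\|$ is the Euclidean norm. Since each $f(\cdot;i)$ is real-valued on $\mathbb{R}^d$, $\mathrm{dom}(F)=\mathbb{R}^d$; each $f(\cdot;i)$ is differentiable. SMG algorithm (Shuffling Momentum Gradient), with parameters $\beta$, number of epochs $T\ge1$, and $\eta_t$: Choose $\tilde w_0\in\mathbb{R}^d$ (deterministic) and set $\tilde m_0:=0$. For $t=1,\dots,T$: set $w_0^{(t)}:=\tilde w_{t-1}$, $m_0^{(t)}:=\tilde m_{t-1}$, $v_0^{(t)}:=0$; generate an arbitrary deterministic or random permutation $\pi^{(t)}$ of $[n]$; for $i=0,\dots,n-1$ put $g_i^{(t)}:=\nabla f(w_i^{(t)};\pi^{(t)}(i+1))$ and $$m_{i+1}^{(t)}:=\beta m_0^{(t)}+(1-\beta)g_i^{(t)},\quad v_{i+1}^{(t)}:=v_i^{(t)}+\tfrac1n g_i^{(t)},\quad w_{i+1}^{(t)}:=w_i^{(t)}-\tfrac{\eta_t}{n}m_{i+1}^{(t)};$$ then set $\tilde w_t:=w_n^{(t)}$ and $\tilde m_t:=v_n^{(t)}$. Output: $\hat w_T\in\{\tilde w_0,\dots,\tilde w_{T-1}\}$ chosen at random (independently of the permutations) with probability $\mathbb{P}[\hat w_T=\tilde w_{t-1}]=\eta_t/\sum_{s=1}^T\eta_s$. *)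

theory Defs
  imports "HOL-Probability.Probability"
begin

definition gradient :: "('a::real_inner \<Rightarrow> real) \<Rightarrow> 'a \<Rightarrow> 'a" where
  "gradient f x = (THE D. GDERIV f x :> D)"

lemma gradient_eqI:
  assumes "GDERIV f x :> D"
  shows "gradient f x = D"
  unfolding gradient_def
proof (rule the_equality)
  fix E assume "GDERIV f x :> E"
  then have "(\<lambda>h. inner h E) = (\<lambda>h. inner h D)"
    using assms unfolding gderiv_def by (rule has_derivative_unique)
  then have "inner h (E - D) = 0" for h
    by (simp add: fun_eq_iff inner_diff_right)
  then have "inner (E - D) (E - D) = 0" .
  then show "E = D" by simp
qed (rule assms)

lemma GDERIV_gradient:
  fixes f :: "'a::euclidean_space \<Rightarrow> real"
  assumes "f differentiable (at x)"
  shows "GDERIV f x :> gradient f x"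
proof -
  obtain f' where f': "(f has_derivative f') (at x)"
    using assms unfolding differentiable_def by blast
  interpret bounded_linear f' using f' by (rule has_derivative_bounded_linear)
  have "f' = (\<lambda>h. inner h (adjoint f' 1))"
    using adjoint_works[of f' _ 1] linear_axioms by (auto simp: fun_eq_iff)
  then have "GDERIV f x :> adjoint f' 1"
    using f' unfolding gderiv_def by simp
  then show ?thesis
    using gradient_eqI by metis
qed

definition avg_obj :: "nat \<Rightarrow> (nat \<Rightarrow> 'a \<Rightarrow> real) \<Rightarrow> 'a \<Rightarrow> real" where
  "avg_obj n f w = (\<Sum>i = 1..n. f i w) / real n"

text \<open>
  One epoch of the method, with initial momentum \<open>m0\<close>, starting point \<open>w0\<close>, step size
  \<open>\<eta> / n\<close> and permutation \<open>p\<close>; the state after \<open>i\<close> steps is the triple of \<open>m\<close>, \<open>v\<close> and \<open>w\<close>.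
  Every momentum update uses the initial momentum \<open>m0\<close> of the epoch, not the momentum of the
  previous step.
\<close>

fun smg_epoch :: "nat \<Rightarrow> (nat \<Rightarrow> 'a::real_inner \<Rightarrow> real) \<Rightarrow> real \<Rightarrow> real \<Rightarrow> 'a \<Rightarrow> 'a \<Rightarrow> (nat \<Rightarrow> nat)
    \<Rightarrow> nat \<Rightarrow> 'a \<times> 'a \<times> 'a" where
  "smg_epoch n f \<beta> \<eta> m0 w0 p 0 = (m0, 0, w0)"
| "smg_epoch n f \<beta> \<eta> m0 w0 p (Suc i) =
    (let (m, v, w) = smg_epoch n f \<beta> \<eta> m0 w0 p i;
         g = gradient (f (p (i + 1))) w;
         m' = \<beta> *\<^sub>R m0 + (1 - \<beta>) *\<^sub>R g
     in (m', v + (1 / real n) *\<^sub>R g, w - (\<eta> / real n) *\<^sub>R m'))"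

text \<open>The pair of the iterate and the momentum at the end of epoch \<open>t\<close>; \<open>\<pi> t\<close> and \<open>\<eta> t\<close> are used in epoch \<open>t\<close>.\<close>

fun smg_state :: "nat \<Rightarrow> (nat \<Rightarrow> 'a::real_inner \<Rightarrow> real) \<Rightarrow> real \<Rightarrow> (nat \<Rightarrow> real) \<Rightarrow> 'a
    \<Rightarrow> (nat \<Rightarrow> nat \<Rightarrow> nat) \<Rightarrow> nat \<Rightarrow> 'a \<times> 'a" where
  "smg_state n f \<beta> \<eta> w0 \<pi> 0 = (w0, 0)"
| "smg_state n f \<beta> \<eta> w0 \<pi> (Suc t) =
    (let (w, m) = smg_state n f \<beta> \<eta> w0 \<pi> t;
         (m', v', w') = smg_epoch n f \<beta> (\<eta> (Suc t)) m w (\<pi> (Suc t)) n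
     in (w', v'))"

definition smg_iter :: "nat \<Rightarrow> (nat \<Rightarrow> 'a::real_inner \<Rightarrow> real) \<Rightarrow> real \<Rightarrow> (nat \<Rightarrow> real) \<Rightarrow> 'a
    \<Rightarrow> (nat \<Rightarrow> nat \<Rightarrow> nat) \<Rightarrow> nat \<Rightarrow> 'a" where
  "smg_iter n f \<beta> \<eta> w0 \<pi> t = fst (smg_state n f \<beta> \<eta> w0 \<pi> t)"

definition index_pmf :: "(nat \<Rightarrow> real) \<Rightarrow> nat \<Rightarrow> nat pmf" where
  "index_pmf \<eta> T = embed_pmf (\<lambda>t. if t \<in> {1..T} then \<eta> t / (\<Sum>s = 1..T. \<eta> s) else 0)"

lemma pmf_index_pmf:
  assumes "T \<ge> 1" and pos: "\<And>t. t \<in> {1..T} \<Longrightarrow> \<eta> t > 0"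
  shows "pmf (index_pmf \<eta> T) t = (if t \<in> {1..T} then \<eta> t / (\<Sum>s = 1..T. \<eta> s) else 0)"
proof -
  let ?p = "\<lambda>t. if t \<in> {1..T} then \<eta> t / (\<Sum>s = 1..T. \<eta> s) else 0"
  have S: "(\<Sum>s = 1..T. \<eta> s) > 0"
    using assms by (intro sum_pos) auto
  have nonneg: "?p t \<ge> 0" for t
    using S pos[of t] by auto
  have "(\<integral>\<^sup>+ t. ennreal (?p t) \<partial>count_space UNIV) = (\<Sum>t = 1..T. ennreal (?p t))"
    by (rule nn_integral_count_space') auto
  also have "\<dots> = ennreal (\<Sum>t = 1..T. ?p t)"
    by (rule sum_ennreal[OF nonneg])
  also have "(\<Sum>t = 1..T. ?p t) = 1"
    using S by (simp add: sum_divide_distrib[symmetric])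
  finally have "(\<integral>\<^sup>+ t. ennreal (?p t) \<partial>count_space UNIV) = 1"
    by (simp only: ennreal_1)
  then show ?thesis
    unfolding index_pmf_def by (rule pmf_embed_pmf[OF nonneg])
qed

text \<open>The law of the random output when the permutations are fixed.\<close>

definition smg_output_pmf :: "nat \<Rightarrow> (nat \<Rightarrow> 'a::real_inner \<Rightarrow> real) \<Rightarrow> real \<Rightarrow> (nat \<Rightarrow> real) \<Rightarrow> 'a
    \<Rightarrow> (nat \<Rightarrow> nat \<Rightarrow> nat) \<Rightarrow> nat \<Rightarrow> 'a pmf" where
  "smg_output_pmf n f \<beta> \<eta> w0 \<pi> T = map_pmf (\<lambda>t. smg_iter n f \<beta> \<eta> w0 \<pi> (t - 1)) (index_pmf \<eta> T)"

text \<open>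
  Arbitrary random permutations \<open>P t\<close> of \<open>{1..n}\<close> (with no restriction on their joint law) and
  a random index \<open>\<tau>\<close> that is independent of the family of all the permutations; the output is
  the iterate at the end of epoch \<open>\<tau> - 1\<close>.
\<close>

definition smg_randomness :: "'b measure \<Rightarrow> nat \<Rightarrow> (nat \<Rightarrow> real) \<Rightarrow> nat
    \<Rightarrow> (nat \<Rightarrow> 'b \<Rightarrow> nat \<Rightarrow> nat) \<Rightarrow> ('b \<Rightarrow> nat) \<Rightarrow> bool" where
  "smg_randomness M n \<eta> T P \<tau> \<longleftrightarrow>
     prob_space M \<and>
     (\<forall>t\<in>{1..T}. P t \<in> measurable M (count_space {p. p permutes {1..n}})) \<and>
     \<tau> \<in> measurable M (count_space {1..T}) \<and>
     (\<forall>t\<in>{1..T}. measure M {\<omega> \<in> space M. \<tau> \<omega> = t} = \<eta> t / (\<Sum>s = 1..T. \<eta> s)) \<and>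
     prob_space.indep_set M
       (sets (vimage_algebra (space M) \<tau> (count_space {1..T})))
       (sets (vimage_algebra (space M) (\<lambda>\<omega>. \<lambda>t\<in>{1..T}. P t \<omega>)
          (PiM {1..T} (\<lambda>_. count_space {p. p permutes {1..n}}))))"

definition smg_output :: "nat \<Rightarrow> (nat \<Rightarrow> 'a::real_inner \<Rightarrow> real) \<Rightarrow> real \<Rightarrow> (nat \<Rightarrow> real) \<Rightarrow> 'a
    \<Rightarrow> (nat \<Rightarrow> 'b \<Rightarrow> nat \<Rightarrow> nat) \<Rightarrow> ('b \<Rightarrow> nat) \<Rightarrow> 'b \<Rightarrow> 'a" where
  "smg_output n f \<beta> \<eta> w0 P \<tau> \<omega> = smg_iter n f \<beta> \<eta> w0 (\<lambda>t. P t \<omega>) (\<tau> \<omega> - 1)"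

end

theory Submission
  imports Defs
begin

text \<open>
  Write \<open>w\<^sub>t\<close> and \<open>m\<^sub>t\<close> for the iterate and the momentum at the end of epoch \<open>t\<close>, so that \<open>m\<^sub>t\<close> is
  the average of the gradients seen in that epoch. One epoch is an inexact gradient step,
  \<open>w\<^sub>t = w\<^sub>t\<^sub>-\<^sub>1 - \<eta>\<^sub>t (\<beta> m\<^sub>t\<^sub>-\<^sub>1 + (1 - \<beta>) m\<^sub>t)\<close>, and by smoothness (\<open>inexact_gradient_step\<close>) it lowers
  \<open>F\<close> by \<open>\<eta>\<^sub>t / 2\<close> times the squared norm of the gradient at \<open>w\<^sub>t\<^sub>-\<^sub>1\<close>, up to \<open>\<eta>\<^sub>t / 2\<close> times the
  squared error of the direction. The latter is at most \<open>\<beta>\<close> times the squared error of \<open>m\<^sub>t\<^sub>-\<^sub>1\<close> plus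
  \<open>1 - \<beta>\<close> times that of \<open>m\<^sub>t\<close>, both as estimates of the gradient at \<open>w\<^sub>t\<^sub>-\<^sub>1\<close>.

  The key estimate is \<open>epoch_error\<close>. Since an epoch visits every component once, the error of
  \<open>m\<^sub>t\<close>, at \<open>w\<^sub>t\<^sub>-\<^sub>1\<close> and at \<open>w\<^sub>t\<close> alike, is governed by how far the iterates move within the epoch,
  and hence by a quantity \<open>u\<^sub>t\<close> of order \<open>(L \<eta>\<^sub>t)\<^sup>2\<close> times squared norms of the
  gradients and \<open>\<sigma>\<^sup>2\<close>. No property of the permutation enters besides its being one. The size of
  \<open>m\<^sub>t\<^sub>-\<^sub>1\<close> is in turn bounded through \<open>u\<^sub>t\<^sub>-\<^sub>1\<close>, which gives a recursion for \<open>u\<^sub>t\<close> with small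
  coefficients. As the step sizes decrease, shifted sums are dominated by unshifted ones
  (\<open>sum_shift_le\<close>), and the sum of the \<open>\<eta>\<^sub>t u\<^sub>t\<close> can be absorbed (\<open>error_recursion_sum\<close>). The first
  epoch is exceptional: its old momentum is \<open>0\<close>, which costs the fraction \<open>\<beta>\<close> of the first gradient
  term; giving up this fraction in every epoch leaves the factor \<open>1 - \<beta>\<close> of the bound.

  The bound is uniform in the permutations. For random permutations the output index is
  independent of them and all these variables take finitely many values, so averaging over the
  index first and then over the permutations preserves it (\<open>indep_finite_expectation_le\<close>).
\<close>

section \<open>Inequalities for sums\<close>

lemma norm_sum_squared_le:
  fixes a :: "'i \<Rightarrow> 'a::real_inner"
  shows "(norm (\<Sum>i\<in>A. a i))\<^sup>2 \<le> real (card A) * (\<Sum>i\<in>A. (norm (a i))\<^sup>2)"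
proof -
  have "(norm (\<Sum>i\<in>A. a i))\<^sup>2 \<le> (\<Sum>i\<in>A. norm (a i))\<^sup>2"
    by (intro power_mono norm_sum norm_ge_zero)
  also have "\<dots> \<le> real (card A) * (\<Sum>i\<in>A. (norm (a i))\<^sup>2)"
    by (cases "A = {}")
      (use sum_squared_le_sum_of_squares[of "\<lambda>i. norm (a i)" A] in \<open>auto simp: mult.commute\<close>)
  finally show ?thesis .
qed

lemma norm_average_squared_le:
  fixes a :: "nat \<Rightarrow> 'a::real_inner"
  assumes "n \<ge> 1"
  shows "(norm ((1 / real n) *\<^sub>R (\<Sum>i<n. a i)))\<^sup>2 \<le> (\<Sum>i<n. (norm (a i))\<^sup>2) / real n"
proof -
  have "(norm ((1 / real n) *\<^sub>R (\<Sum>i<n. a i)))\<^sup>2 = (norm (\<Sum>i<n. a i))\<^sup>2 / (real n)\<^sup>2"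
    by (simp add: power_divide)
  also have "\<dots> \<le> (real n * (\<Sum>i<n. (norm (a i))\<^sup>2)) / (real n)\<^sup>2"
    using norm_sum_squared_le[of a "{..<n}"] by (intro divide_right_mono) auto
  also have "\<dots> = (\<Sum>i<n. (norm (a i))\<^sup>2) / real n"
    using assms by (simp add: power2_eq_square)
  finally show ?thesis .
qed

lemma norm_add_squared_le:
  fixes a b :: "'a::real_inner"
  shows "(norm (a + b))\<^sup>2 \<le> 2 * (norm a)\<^sup>2 + 2 * (norm b)\<^sup>2"
  using zero_le_power2[of "norm (a - b)"]
  by (simp add: power2_norm_eq_inner inner_simps inner_commute)

lemma norm_add3_squared_le:
  fixes a b c :: "'a::real_inner"
  shows "(norm (a + b + c))\<^sup>2 \<le> 3 * ((norm a)\<^sup>2 + (norm b)\<^sup>2 + (norm c)\<^sup>2)"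
  using zero_le_power2[of "norm (a - b)"] zero_le_power2[of "norm (b - c)"]
    zero_le_power2[of "norm (a - c)"]
  by (simp add: power2_norm_eq_inner inner_simps inner_commute)

lemma norm_convex_squared_le:
  fixes a b :: "'a::real_inner"
  assumes "0 \<le> \<beta>" "\<beta> \<le> 1"
  shows "(norm (\<beta> *\<^sub>R a + (1 - \<beta>) *\<^sub>R b))\<^sup>2 \<le> \<beta> * (norm a)\<^sup>2 + (1 - \<beta>) * (norm b)\<^sup>2"
proof -
  have "\<beta> * (norm a)\<^sup>2 + (1 - \<beta>) * (norm b)\<^sup>2 - (norm (\<beta> *\<^sub>R a + (1 - \<beta>) *\<^sub>R b))\<^sup>2
      = \<beta> * (1 - \<beta>) * (norm (a - b))\<^sup>2"
    by (simp add: power2_norm_eq_inner inner_simps inner_commute) algebra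
  also have "\<dots> \<ge> 0"
    using assms by simp
  finally show ?thesis by simp
qed

lemma sum_shift_le:
  fixes h a :: "nat \<Rightarrow> real"
  assumes a0: "a 0 = 0" and nonneg: "\<And>t. t \<le> T \<Longrightarrow> a t \<ge> 0"
    and decr: "\<And>t. t \<ge> 1 \<Longrightarrow> h (t + 1) \<le> h t" and pos: "\<And>t. t \<ge> 1 \<Longrightarrow> h t \<ge> 0"
  shows "(\<Sum>t = 1..T. h t * a (t - 1)) \<le> (\<Sum>t = 1..T. h t * a t)"
proof (cases T)
  case (Suc k)
  have "(\<Sum>t = 1..Suc k. h t * a (t - 1)) = (\<Sum>t = 0..k. h (Suc t) * a t)"
    using sum.shift_bounds_cl_Suc_ivl[of "\<lambda>t. h t * a (t - 1)" 0 k] by simp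
  also have "\<dots> = (\<Sum>t = 1..k. h (Suc t) * a t)"
    using a0 by (simp add: sum.atLeast_Suc_atMost)
  also have "\<dots> \<le> (\<Sum>t = 1..k. h t * a t)"
    using decr nonneg Suc by (intro sum_mono mult_right_mono) auto
  also have "\<dots> \<le> (\<Sum>t = 1..Suc k. h t * a t)"
    using pos[of "Suc k"] nonneg[of "Suc k"] Suc by simp
  finally show ?thesis using Suc by simp
qed simp

section \<open>The descent inequality for smooth functions\<close>

lemma smooth_upper_bound:
  fixes F :: "'a::real_inner \<Rightarrow> real"
  assumes deriv: "\<And>w. GDERIV F w :> g w"
    and lip: "\<And>w w'. norm (g w - g w') \<le> L * norm (w - w')"
  shows "F (x + h) \<le> F x + inner (g x) h + L / 2 * (norm h)\<^sup>2"
proof -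
  define \<phi> where "\<phi> s = F (x + s *\<^sub>R h) - s * inner (g x) h - L / 2 * s\<^sup>2 * (norm h)\<^sup>2" for s
  have "\<phi> 1 \<le> \<phi> 0"
  proof (rule DERIV_nonpos_imp_nonincreasing[of 0 1])
    fix s :: real assume s: "0 \<le> s" "s \<le> 1"
    have "(F has_derivative (\<lambda>k. inner k (g (x + s *\<^sub>R h)))) (at (x + s *\<^sub>R h))"
      using deriv unfolding gderiv_def .
    then have "((\<lambda>s. F (x + s *\<^sub>R h)) has_derivative (\<lambda>r. inner (r *\<^sub>R h) (g (x + s *\<^sub>R h)))) (at s)"
      by (rule has_derivative_compose[rotated]) (auto intro!: derivative_eq_intros)
    then have 1: "((\<lambda>s. F (x + s *\<^sub>R h)) has_real_derivative inner h (g (x + s *\<^sub>R h))) (at s)"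
      unfolding has_field_derivative_def by (rule has_derivative_eq_rhs) (auto simp: mult.commute)
    have "(\<phi> has_real_derivative
        inner h (g (x + s *\<^sub>R h)) - inner (g x) h - L * s * (norm h)\<^sup>2) (at s)"
      unfolding \<phi>_def by (rule derivative_eq_intros 1 refl | simp)+
    moreover have "inner h (g (x + s *\<^sub>R h)) - inner (g x) h - L * s * (norm h)\<^sup>2 \<le> 0"
    proof -
      have "inner h (g (x + s *\<^sub>R h)) - inner (g x) h = inner h (g (x + s *\<^sub>R h) - g x)"
        by (simp add: inner_diff_right inner_commute)
      also have "\<dots> \<le> norm h * norm (g (x + s *\<^sub>R h) - g x)"
        by (rule norm_cauchy_schwarz)
      also have "\<dots> \<le> norm h * (L * norm (x + s *\<^sub>R h - x))"
        by (intro mult_left_mono lip) auto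
      also have "\<dots> = L * s * (norm h)\<^sup>2"
        using s by (simp add: power2_eq_square)
      finally show ?thesis by simp
    qed
    ultimately show "\<exists>y. (\<phi> has_real_derivative y) (at s) \<and> y \<le> 0" by blast
  qed simp
  then show ?thesis by (simp add: \<phi>_def)
qed

lemma inexact_gradient_step:
  fixes F :: "'a::real_inner \<Rightarrow> real"
  assumes deriv: "\<And>w. GDERIV F w :> g w"
    and lip: "\<And>w w'. norm (g w - g w') \<le> L * norm (w - w')"
    and \<eta>: "0 \<le> \<eta>" "L * \<eta> \<le> 1"
  shows "F (x - \<eta> *\<^sub>R d) \<le> F x - \<eta> / 2 * (norm (g x))\<^sup>2 + \<eta> / 2 * (norm (g x - d))\<^sup>2"
proof -
  have "F (x - \<eta> *\<^sub>R d) \<le> F x - \<eta> * inner (g x) d + L / 2 * (\<eta>\<^sup>2 * (norm d)\<^sup>2)"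
    using smooth_upper_bound[OF deriv lip, of x "- (\<eta> *\<^sub>R d)"]
    by (simp add: power_mult_distrib)
  also have "L / 2 * (\<eta>\<^sup>2 * (norm d)\<^sup>2) \<le> \<eta> / 2 * (norm d)\<^sup>2"
  proof -
    have "(L * \<eta>) * (\<eta> * (norm d)\<^sup>2) \<le> 1 * (\<eta> * (norm d)\<^sup>2)"
      using \<eta> by (intro mult_right_mono) auto
    then show ?thesis by (simp add: power2_eq_square mult_ac)
  qed
  also have "F x - \<eta> * inner (g x) d + \<eta> / 2 * (norm d)\<^sup>2
      = F x - \<eta> / 2 * (norm (g x))\<^sup>2 + \<eta> / 2 * (norm (g x - d))\<^sup>2"
    unfolding power2_norm_eq_inner by (simp add: inner_simps inner_commute field_simps)
  finally show ?thesis by simp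
qed

section \<open>One epoch\<close>

lemma smg_epoch_iterate_diff:
  assumes "a \<le> b"
  shows "snd (snd (smg_epoch n f \<beta> \<eta> m w p b)) = snd (snd (smg_epoch n f \<beta> \<eta> m w p a))
    - (\<eta> / real n) *\<^sub>R (\<Sum>j = a..<b. \<beta> *\<^sub>R m
        + (1 - \<beta>) *\<^sub>R gradient (f (p (j + 1))) (snd (snd (smg_epoch n f \<beta> \<eta> m w p j))))"
  using assms
  by (induction b rule: dec_induct)
    (auto simp: Let_def case_prod_beta scaleR_add_right algebra_simps)

lemma smg_epoch_average:
  "fst (snd (smg_epoch n f \<beta> \<eta> m w p k)) = (1 / real n) *\<^sub>R
    (\<Sum>j<k. gradient (f (p (j + 1))) (snd (snd (smg_epoch n f \<beta> \<eta> m w p j))))"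
  by (induction k) (auto simp: Let_def case_prod_beta scaleR_add_right)

text \<open>
  A finite sum of differentiable functions whose gradients are \<open>L\<close>-Lipschitz and deviate from
  the gradient of the average \<open>avg_obj n f\<close>, in mean square, by at most an affine function of the
  squared norm of the latter.
\<close>

locale smooth_finite_sum =
  fixes n :: nat and f :: "nat \<Rightarrow> 'a::euclidean_space \<Rightarrow> real" and L \<Theta> \<sigma> :: real
  assumes n: "n \<ge> 1" and L: "L > 0"
    and diff: "\<And>i w. i \<in> {1..n} \<Longrightarrow> f i differentiable (at w)"
    and smooth: "\<And>i w w'. i \<in> {1..n} \<Longrightarrow>
        norm (gradient (f i) w - gradient (f i) w') \<le> L * norm (w - w')"
    and variance: "\<And>w. (\<Sum>i = 1..n. (norm (gradient (f i) w - gradient (avg_obj n f) w))\<^sup>2) / real n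
        \<le> \<Theta> * (norm (gradient (avg_obj n f) w))\<^sup>2 + \<sigma>\<^sup>2"
begin

text \<open>The full gradient, that is, the gradient of the average.\<close>

abbreviation gradF :: "'a \<Rightarrow> 'a" where
  "gradF \<equiv> gradient (avg_obj n f)"

lemma GDERIV_avg_obj_sum:
  "GDERIV (avg_obj n f) w :> (1 / real n) *\<^sub>R (\<Sum>i = 1..n. gradient (f i) w)"
proof -
  have "(f i has_derivative (\<lambda>h. inner h (gradient (f i) w))) (at w)" if "i \<in> {1..n}" for i
    using GDERIV_gradient[OF diff[OF that]] unfolding gderiv_def .
  then have "((\<lambda>w. \<Sum>i = 1..n. f i w) has_derivative
      (\<lambda>h. \<Sum>i = 1..n. inner h (gradient (f i) w))) (at w)"
    by (rule has_derivative_sum)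
  then have "((\<lambda>w. (1 / real n) * (\<Sum>i = 1..n. f i w)) has_derivative
      (\<lambda>h. (1 / real n) * (\<Sum>i = 1..n. inner h (gradient (f i) w)))) (at w)"
    by (rule has_derivative_mult_right)
  then show ?thesis
    unfolding gderiv_def avg_obj_def by (simp add: inner_sum_right)
qed

lemma gradient_avg_obj:
  "gradF w = (1 / real n) *\<^sub>R (\<Sum>i = 1..n. gradient (f i) w)"
  by (rule gradient_eqI) (rule GDERIV_avg_obj_sum)

lemma GDERIV_avg_obj: "GDERIV (avg_obj n f) w :> gradF w"
  using GDERIV_avg_obj_sum gradient_avg_obj by metis

lemma sum_permuted:
  assumes "p permutes {1..n}"
  shows "(\<Sum>j<n. h (p (j + 1))) = (\<Sum>i = 1..n. h i)"
proof -
  have "(\<Sum>j<n. h (p (j + 1))) = (\<Sum>i = 1..n. h (p i))"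
    using sum.atLeast1_atMost_eq[of "\<lambda>i. h (p i)" n] by simp
  also have "\<dots> = (\<Sum>i = 1..n. h i)"
    using sum.permute[OF assms, of h] by (simp add: comp_def)
  finally show ?thesis .
qed

lemma permuted_index:
  assumes "p permutes {1..n}" "j < n"
  shows "p (j + 1) \<in> {1..n}"
  using permutes_in_image[OF assms(1), of "j + 1"] assms(2) by auto

text \<open>
  Each component is used exactly once, so the full gradient at \<open>w\<close> is the average of the same
  component gradients, all taken at \<open>w\<close>; only the displacement of the points \<open>W j\<close> from \<open>w\<close>
  contributes to the error.
\<close>

lemma average_gradient_error:
  assumes p: "p permutes {1..n}"
  shows "(norm (gradF w - (1 / real n) *\<^sub>R (\<Sum>j<n. gradient (f (p (j + 1))) (W j))))\<^sup>2
    \<le> L\<^sup>2 * ((\<Sum>j<n. (norm (W j - w))\<^sup>2) / real n)"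
proof -
  let ?g = "\<lambda>j. gradient (f (p (j + 1)))"
  have "gradF w = (1 / real n) *\<^sub>R (\<Sum>j<n. ?g j w)"
    using sum_permuted[OF p, of "\<lambda>i. gradient (f i) w"] gradient_avg_obj by simp
  then have "(norm (gradF w - (1 / real n) *\<^sub>R (\<Sum>j<n. ?g j (W j))))\<^sup>2
      = (norm ((1 / real n) *\<^sub>R (\<Sum>j<n. ?g j w - ?g j (W j))))\<^sup>2"
    by (simp add: sum_subtractf scaleR_diff_right)
  also have "\<dots> \<le> (\<Sum>j<n. (norm (?g j w - ?g j (W j)))\<^sup>2) / real n"
    by (rule norm_average_squared_le[OF n])
  also have "\<dots> \<le> (\<Sum>j<n. L\<^sup>2 * (norm (W j - w))\<^sup>2) / real n"
  proof (intro divide_right_mono sum_mono)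
    fix j assume "j \<in> {..<n}"
    then have "norm (?g j w - ?g j (W j)) \<le> L * norm (W j - w)"
      using smooth[OF permuted_index[OF p]] by (metis lessThan_iff norm_minus_commute)
    then have "(norm (?g j w - ?g j (W j)))\<^sup>2 \<le> (L * norm (W j - w))\<^sup>2"
      by (intro power_mono) auto
    then show "(norm (?g j w - ?g j (W j)))\<^sup>2 \<le> L\<^sup>2 * (norm (W j - w))\<^sup>2"
      by (simp add: power_mult_distrib)
  qed simp
  also have "\<dots> = L\<^sup>2 * ((\<Sum>j<n. (norm (W j - w))\<^sup>2) / real n)"
    by (simp add: sum_distrib_left)
  finally show ?thesis .
qed

lemma gradF_lipschitz: "norm (gradF w - gradF w') \<le> L * norm (w - w')"
proof (rule power2_le_imp_le)
  show "(norm (gradF w - gradF w'))\<^sup>2 \<le> (L * norm (w - w'))\<^sup>2"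
    using average_gradient_error[OF permutes_id, of w "\<lambda>_. w'"] n
      sum_permuted[OF permutes_id, of "\<lambda>i. gradient (f i) w'"]
    by (simp add: gradient_avg_obj[of w'] power_mult_distrib norm_minus_commute)
  show "0 \<le> L * norm (w - w')" using L by simp
qed

text \<open>
  All distances between iterates of one epoch are controlled by the same quantity, which yields
  a single error \<open>u\<close> that bounds the squared deviation of the new momentum \<open>m'\<close> from the full gradient
  both at the start \<open>w\<close> and at the end \<open>w'\<close> of the epoch. The latter is what the next epoch
  needs, since it reuses \<open>m'\<close>. The bound on \<open>u\<close> contains \<open>u\<close> itself, because the gradients of the
  epoch are compared with those at \<open>w\<close>.
\<close>

lemma epoch_error:
  assumes p: "p permutes {1..n}" and \<beta>: "0 \<le> \<beta>" "\<beta> \<le> 1"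
    and epoch: "smg_epoch n f \<beta> \<eta> m w p n = (m'', m', w')"
  obtains u where "w' = w - \<eta> *\<^sub>R (\<beta> *\<^sub>R m + (1 - \<beta>) *\<^sub>R m')"
    and "(norm (gradF w - m'))\<^sup>2 \<le> u" and "(norm (gradF w' - m'))\<^sup>2 \<le> u"
    and "u \<le> (L * \<eta>)\<^sup>2 * (\<beta> * (norm m)\<^sup>2
      + 3 * (1 - \<beta>) * (u + (\<Theta> + 1) * (norm (gradF w))\<^sup>2 + \<sigma>\<^sup>2))"
proof -
  define W where "W j = snd (snd (smg_epoch n f \<beta> \<eta> m w p j))" for j
  define g where "g j = gradient (f (p (j + 1))) (W j)" for j
  define D where "D = (\<Sum>j<n. (norm (W j - w))\<^sup>2) / real n"
  define R where "R = \<beta> * (norm m)\<^sup>2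
      + 3 * (1 - \<beta>) * (L\<^sup>2 * D + (\<Theta> + 1) * (norm (gradF w))\<^sup>2 + \<sigma>\<^sup>2)"
  have W0: "W 0 = w" and Wn: "W n = w'" by (simp_all add: W_def epoch)
  have m': "m' = (1 / real n) *\<^sub>R (\<Sum>j<n. g j)"
    using smg_epoch_average[of n f \<beta> \<eta> m w p n] by (simp add: epoch g_def W_def)
  have W_diff: "W b = W a - (\<eta> / real n) *\<^sub>R (\<Sum>j = a..<b. \<beta> *\<^sub>R m + (1 - \<beta>) *\<^sub>R g j)"
    if "a \<le> b" for a b
    using smg_epoch_iterate_diff[OF that, of n f \<beta> \<eta> m w p] unfolding W_def g_def .
  have g_sum: "(\<Sum>j<n. (norm (g j))\<^sup>2) / real n
      \<le> 3 * (L\<^sup>2 * D + (\<Theta> + 1) * (norm (gradF w))\<^sup>2 + \<sigma>\<^sup>2)"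
  proof -
    let ?c = "\<lambda>j. gradient (f (p (j + 1))) w"
    have "(norm (g j))\<^sup>2 \<le> 3 * (L\<^sup>2 * (norm (W j - w))\<^sup>2 + (norm (?c j - gradF w))\<^sup>2 + (norm (gradF w))\<^sup>2)"
      if "j < n" for j
    proof -
      have "norm (g j - ?c j) \<le> L * norm (W j - w)"
        using smooth[OF permuted_index[OF p that]] unfolding g_def .
      then have "(norm (g j - ?c j))\<^sup>2 \<le> L\<^sup>2 * (norm (W j - w))\<^sup>2"
        by (metis norm_ge_zero power_mono power_mult_distrib)
      then show ?thesis
        using norm_add3_squared_le[of "g j - ?c j" "?c j - gradF w" "gradF w"] by simp
    qed
    then have "(\<Sum>j<n. (norm (g j))\<^sup>2) \<le> (\<Sum>j<n. 3 * (L\<^sup>2 * (norm (W j - w))\<^sup>2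
        + (norm (?c j - gradF w))\<^sup>2 + (norm (gradF w))\<^sup>2))"
      by (intro sum_mono) auto
    also have "\<dots> = 3 * (L\<^sup>2 * (\<Sum>j<n. (norm (W j - w))\<^sup>2)
        + (\<Sum>j<n. (norm (?c j - gradF w))\<^sup>2) + real n * (norm (gradF w))\<^sup>2)"
      by (simp add: sum.distrib flip: sum_distrib_left)
    finally have "(\<Sum>j<n. (norm (g j))\<^sup>2) / real n
        \<le> 3 * (L\<^sup>2 * (\<Sum>j<n. (norm (W j - w))\<^sup>2)
          + (\<Sum>j<n. (norm (?c j - gradF w))\<^sup>2) + real n * (norm (gradF w))\<^sup>2) / real n"
      by (rule divide_right_mono) simp
    also have "\<dots> = 3 * (L\<^sup>2 * D + (\<Sum>j<n. (norm (?c j - gradF w))\<^sup>2) / real n + (norm (gradF w))\<^sup>2)"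
      using n by (simp add: D_def field_simps)
    also have "(\<Sum>j<n. (norm (?c j - gradF w))\<^sup>2) = (\<Sum>i = 1..n. (norm (gradient (f i) w - gradF w))\<^sup>2)"
      using sum_permuted[OF p, of "\<lambda>i. (norm (gradient (f i) w - gradF w))\<^sup>2"] .
    finally show ?thesis using variance[of w] by (simp add: algebra_simps)
  qed
  have W_close: "(norm (W b - W a))\<^sup>2 \<le> \<eta>\<^sup>2 * R" if ab: "a \<le> b" "b \<le> n" for a b
  proof -
    let ?d = "\<lambda>j. \<beta> *\<^sub>R m + (1 - \<beta>) *\<^sub>R g j"
    have "(norm (W b - W a))\<^sup>2 = (\<eta> / real n)\<^sup>2 * (norm (\<Sum>j = a..<b. ?d j))\<^sup>2"
      using W_diff[OF ab(1)] by (simp add: power_mult_distrib power_divide)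
    also have "\<dots> \<le> (\<eta> / real n)\<^sup>2 * (real n * (\<Sum>j<n. (norm (?d j))\<^sup>2))"
    proof (rule mult_left_mono)
      have "(norm (\<Sum>j = a..<b. ?d j))\<^sup>2 \<le> real (b - a) * (\<Sum>j = a..<b. (norm (?d j))\<^sup>2)"
        using norm_sum_squared_le[of ?d "{a..<b}"] by simp
      also have "\<dots> \<le> real n * (\<Sum>j<n. (norm (?d j))\<^sup>2)"
        using ab by (intro mult_mono sum_mono2 sum_nonneg) auto
      finally show "(norm (\<Sum>j = a..<b. ?d j))\<^sup>2 \<le> real n * (\<Sum>j<n. (norm (?d j))\<^sup>2)" .
    qed simp
    also have "\<dots> = \<eta>\<^sup>2 * ((\<Sum>j<n. (norm (?d j))\<^sup>2) / real n)"
      using n by (simp add: power2_eq_square)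
    also have "\<dots> \<le> \<eta>\<^sup>2 * ((\<Sum>j<n. \<beta> * (norm m)\<^sup>2 + (1 - \<beta>) * (norm (g j))\<^sup>2) / real n)"
      by (intro mult_left_mono divide_right_mono sum_mono norm_convex_squared_le \<beta>) auto
    also have "\<dots> = \<eta>\<^sup>2 * (\<beta> * (norm m)\<^sup>2 + (1 - \<beta>) * ((\<Sum>j<n. (norm (g j))\<^sup>2) / real n))"
      using n by (simp add: sum.distrib add_divide_distrib flip: sum_distrib_left)
    also have "\<dots> \<le> \<eta>\<^sup>2 * R"
      using mult_left_mono[OF g_sum, of "1 - \<beta>"] \<beta>
      unfolding R_def by (intro mult_left_mono add_left_mono) (simp_all only: mult_ac, simp_all)
    finally show ?thesis .
  qed
  have mean_le: "(\<Sum>j<n. (norm (W j - z))\<^sup>2) / real n \<le> \<eta>\<^sup>2 * R"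
    if "\<And>j. j < n \<Longrightarrow> (norm (W j - z))\<^sup>2 \<le> \<eta>\<^sup>2 * R" for z
    using sum_bounded_above[of "{..<n}" "\<lambda>j. (norm (W j - z))\<^sup>2" "\<eta>\<^sup>2 * R"] that n
    by (simp add: divide_le_eq mult.commute)
  have start: "(\<Sum>j<n. (norm (W j - w))\<^sup>2) / real n \<le> \<eta>\<^sup>2 * R"
    using W_close[of 0] by (intro mean_le) (auto simp: W0)
  have final: "(\<Sum>j<n. (norm (W j - w'))\<^sup>2) / real n \<le> \<eta>\<^sup>2 * R"
    using W_close[of _ n] by (intro mean_le) (auto simp: Wn norm_minus_commute)
  define u where "u = L\<^sup>2 * (\<eta>\<^sup>2 * R)"
  show thesis
  proof (rule that[of u])
    have "w' = w - (\<eta> / real n) *\<^sub>R (\<Sum>j<n. \<beta> *\<^sub>R m + (1 - \<beta>) *\<^sub>R g j)"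
      using W_diff[of 0 n] by (simp add: W0 Wn atLeast0LessThan)
    also have "(\<Sum>j<n. \<beta> *\<^sub>R m + (1 - \<beta>) *\<^sub>R g j)
        = real n *\<^sub>R (\<beta> *\<^sub>R m + (1 - \<beta>) *\<^sub>R m')"
      using n unfolding sum.distrib scaleR_sum_right[symmetric] m'
      by (simp add: scaleR_add_right sum_constant_scaleR)
    finally show "w' = w - \<eta> *\<^sub>R (\<beta> *\<^sub>R m + (1 - \<beta>) *\<^sub>R m')"
      using n by simp
    show "(norm (gradF w - m'))\<^sup>2 \<le> u"
      using average_gradient_error[OF p, of w W] mult_left_mono[OF start, of "L\<^sup>2"]
      unfolding m' g_def u_def by simp
    show "(norm (gradF w' - m'))\<^sup>2 \<le> u"
      using average_gradient_error[OF p, of w' W] mult_left_mono[OF final, of "L\<^sup>2"]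
      unfolding m' g_def u_def by simp
    have "L\<^sup>2 * D \<le> u"
      using mult_left_mono[OF start, of "L\<^sup>2"] unfolding D_def u_def by simp
    then have "R \<le> \<beta> * (norm m)\<^sup>2 + 3 * (1 - \<beta>) * (u + (\<Theta> + 1) * (norm (gradF w))\<^sup>2 + \<sigma>\<^sup>2)"
      using \<beta> unfolding R_def by (intro add_left_mono mult_left_mono add_right_mono) auto
    then have "(L * \<eta>)\<^sup>2 * R \<le> (L * \<eta>)\<^sup>2 * (\<beta> * (norm m)\<^sup>2
        + 3 * (1 - \<beta>) * (u + (\<Theta> + 1) * (norm (gradF w))\<^sup>2 + \<sigma>\<^sup>2))"
      by (intro mult_left_mono) auto
    then show "u \<le> (L * \<eta>)\<^sup>2 * (\<beta> * (norm m)\<^sup>2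
        + 3 * (1 - \<beta>) * (u + (\<Theta> + 1) * (norm (gradF w))\<^sup>2 + \<sigma>\<^sup>2))"
      by (simp add: u_def power_mult_distrib)
  qed
qed

end

section \<open>Summation over the epochs\<close>

text \<open>
  The scalar part of the argument: \<open>\<Phi>\<close> stands for the objective values, \<open>G\<close> for the squared
  gradient norms and \<open>u\<close> for the errors of the epochs. Since \<open>u\<close> is bounded by a small multiple
  of itself, of its predecessor, of the values of \<open>G\<close> and of \<open>\<sigma>\<^sup>2\<close>, its weighted sum can be solved
  for. The values at \<open>0\<close> are set to \<open>0\<close>, as no epoch precedes the first one.
\<close>

lemma error_recursion_sum:
  fixes \<Phi> G u \<eta> :: "nat \<Rightarrow> real"
  assumes step: "\<And>t. t \<in> {1..T} \<Longrightarrow> \<Phi> t \<le> \<Phi> (t - 1) - (1 - \<beta>) / 2 * (\<eta> t * G t)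
      + \<eta> t / 2 * (\<beta> * u (t - 1) + (1 - \<beta>) * u t)"
    and rec: "\<And>t. t \<in> {1..T} \<Longrightarrow> u t \<le> (L * \<eta> t)\<^sup>2 * (2 * (u (t - 1) + G (t - 1))
      + 3 * (u t + (\<Theta> + 1) * G t + \<sigma>\<^sup>2))"
    and zero: "u 0 = 0" "G 0 = 0"
    and nonneg: "\<And>t. t \<le> T \<Longrightarrow> u t \<ge> 0" "\<And>t. t \<le> T \<Longrightarrow> G t \<ge> 0"
    and decr: "\<And>t. t \<ge> 1 \<Longrightarrow> \<eta> (t + 1) \<le> \<eta> t" and pos: "\<And>t. t \<ge> 1 \<Longrightarrow> \<eta> t \<ge> 0"
    and \<Theta>: "\<Theta> \<ge> 0" and \<beta>: "0 \<le> \<beta>" "\<beta> \<le> 1"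
    and small: "\<And>t. t \<ge> 1 \<Longrightarrow> (L * \<eta> t)\<^sup>2 \<le> 1 / 45"
      "\<And>t. t \<ge> 1 \<Longrightarrow> (L * \<eta> t)\<^sup>2 * (\<Theta> + 1) \<le> (1 - \<beta>) / 18"
  shows "(1 - \<beta>) / 4 * (\<Sum>t = 1..T. \<eta> t * G t)
    \<le> \<Phi> 0 - \<Phi> T + 2 * L\<^sup>2 * \<sigma>\<^sup>2 * (\<Sum>t = 1..T. \<eta> t ^ 3)"
proof -
  define S where "S = (\<Sum>t = 1..T. \<eta> t * u t)"
  define \<Gamma> where "\<Gamma> = (\<Sum>t = 1..T. \<eta> t * G t)"
  define H where "H = (\<Sum>t = 1..T. \<eta> t ^ 3)"
  define c where "c = (1 - \<beta>) / 18"
  have c: "c \<ge> 0" using \<beta> by (simp add: c_def)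
  have shift_u: "(\<Sum>t = 1..T. \<eta> t * u (t - 1)) \<le> S"
    unfolding S_def using zero nonneg decr pos by (intro sum_shift_le) auto
  have shift_G: "(\<Sum>t = 1..T. \<eta> t * G (t - 1)) \<le> \<Gamma>"
    unfolding \<Gamma>_def using zero nonneg decr pos by (intro sum_shift_le) auto
  have \<Gamma>: "\<Gamma> \<ge> 0" unfolding \<Gamma>_def using pos nonneg by (intro sum_nonneg) auto

  have "\<eta> t * u t \<le> 2 / 45 * (\<eta> t * u (t - 1)) + 2 * c * (\<eta> t * G (t - 1))
      + 1 / 15 * (\<eta> t * u t) + 3 * c * (\<eta> t * G t) + 3 * L\<^sup>2 * \<sigma>\<^sup>2 * \<eta> t ^ 3"
    if t: "t \<in> {1..T}" for t
  proof -
    define q where "q = (L * \<eta> t)\<^sup>2"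
    have q: "0 \<le> q" "q \<le> 1 / 45" "q * (\<Theta> + 1) \<le> c"
      using small[of t] t by (auto simp: q_def c_def)
    have "q * 1 \<le> q * (\<Theta> + 1)" using \<Theta> q by (intro mult_left_mono) auto
    then have qc: "q \<le> c" using q by simp
    have nn: "u t \<ge> 0" "u (t - 1) \<ge> 0" "G t \<ge> 0" "G (t - 1) \<ge> 0" "\<eta> t \<ge> 0"
      using nonneg pos t by auto
    have "u t \<le> 2 * (q * u (t - 1)) + 2 * (q * G (t - 1)) + 3 * (q * u t)
        + 3 * ((q * (\<Theta> + 1)) * G t) + 3 * q * \<sigma>\<^sup>2"
      using rec[OF t] unfolding q_def[symmetric] by (simp add: algebra_simps)
    also have "\<dots> \<le> 2 * (1 / 45 * u (t - 1)) + 2 * (c * G (t - 1)) + 3 * (1 / 45 * u t)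
        + 3 * (c * G t) + 3 * q * \<sigma>\<^sup>2"
      using nn q qc by (intro add_mono mult_left_mono mult_right_mono order_refl) auto
    finally have "\<eta> t * u t \<le> \<eta> t * (2 * (1 / 45 * u (t - 1)) + 2 * (c * G (t - 1))
        + 3 * (1 / 45 * u t) + 3 * (c * G t) + 3 * q * \<sigma>\<^sup>2)"
      using nn by (intro mult_left_mono) auto
    then show ?thesis
      by (simp add: q_def power_mult_distrib power2_eq_square power3_eq_cube algebra_simps)
  qed
  then have "S \<le> (\<Sum>t = 1..T. 2 / 45 * (\<eta> t * u (t - 1)) + 2 * c * (\<eta> t * G (t - 1))
      + 1 / 15 * (\<eta> t * u t) + 3 * c * (\<eta> t * G t) + 3 * L\<^sup>2 * \<sigma>\<^sup>2 * \<eta> t ^ 3)"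
    unfolding S_def by (rule sum_mono)
  also have "\<dots> = 2 / 45 * (\<Sum>t = 1..T. \<eta> t * u (t - 1)) + 2 * c * (\<Sum>t = 1..T. \<eta> t * G (t - 1))
      + 1 / 15 * S + 3 * c * \<Gamma> + 3 * L\<^sup>2 * \<sigma>\<^sup>2 * H"
    unfolding S_def \<Gamma>_def H_def sum.distrib sum_distrib_left ..
  also have "\<dots> \<le> 2 / 45 * S + 2 * c * \<Gamma> + 1 / 15 * S + 3 * c * \<Gamma> + 3 * L\<^sup>2 * \<sigma>\<^sup>2 * H"
    using shift_u shift_G c by (intro add_mono mult_left_mono order_refl) auto
  finally have "S \<le> 2 / 45 * S + 2 * (c * \<Gamma>) + 1 / 15 * S + 3 * (c * \<Gamma>) + 3 * (L\<^sup>2 * \<sigma>\<^sup>2 * H)"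
    by (simp only: mult.assoc)
  then have S: "S \<le> 45 / 8 * (c * \<Gamma>) + 27 / 8 * (L\<^sup>2 * \<sigma>\<^sup>2 * H)"
    by linarith

  have "(\<Sum>t = 1..T. \<Phi> t) \<le> (\<Sum>t = 1..T. \<Phi> (t - 1) - (1 - \<beta>) / 2 * (\<eta> t * G t)
      + (\<beta> / 2 * (\<eta> t * u (t - 1)) + (1 - \<beta>) / 2 * (\<eta> t * u t)))"
  proof (rule sum_mono)
    fix t assume "t \<in> {1..T}"
    from step[OF this] show "\<Phi> t \<le> \<Phi> (t - 1) - (1 - \<beta>) / 2 * (\<eta> t * G t)
      + (\<beta> / 2 * (\<eta> t * u (t - 1)) + (1 - \<beta>) / 2 * (\<eta> t * u t))"
      by (simp add: field_simps)
  qed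
  also have "\<dots> = (\<Sum>t = 1..T. \<Phi> (t - 1)) - (1 - \<beta>) / 2 * \<Gamma>
      + (\<beta> / 2 * (\<Sum>t = 1..T. \<eta> t * u (t - 1)) + (1 - \<beta>) / 2 * S)"
    unfolding S_def \<Gamma>_def sum.distrib sum_subtractf sum_distrib_left ..
  also have "\<dots> \<le> (\<Sum>t = 1..T. \<Phi> (t - 1)) - (1 - \<beta>) / 2 * \<Gamma>
      + (\<beta> / 2 * S + (1 - \<beta>) / 2 * S)"
    using shift_u \<beta> by (intro add_mono mult_left_mono order_refl) auto
  also have "\<beta> / 2 * S + (1 - \<beta>) / 2 * S = S / 2"
    by (simp add: field_simps)
  finally have "(\<Sum>t = 1..T. \<Phi> t) - (\<Sum>t = 1..T. \<Phi> (t - 1)) \<le> S / 2 - (1 - \<beta>) / 2 * \<Gamma>"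
    by simp
  moreover have "(\<Sum>t = 1..T. \<Phi> t) - (\<Sum>t = 1..T. \<Phi> (t - 1)) = \<Phi> T - \<Phi> 0"
    by (induction T) auto
  ultimately have "(1 - \<beta>) / 2 * \<Gamma> \<le> \<Phi> 0 - \<Phi> T + S / 2"
    by simp
  moreover have "(1 - \<beta>) / 2 * \<Gamma> = 9 * (c * \<Gamma>)" "(1 - \<beta>) / 4 * \<Gamma> = 9 / 2 * (c * \<Gamma>)"
    by (simp_all add: c_def)
  moreover have "2 * L\<^sup>2 * \<sigma>\<^sup>2 * H = 2 * (L\<^sup>2 * \<sigma>\<^sup>2 * H)" by simp
  moreover have "c * \<Gamma> \<ge> 0" using c \<Gamma> by simp
  moreover have "L\<^sup>2 * \<sigma>\<^sup>2 * H \<ge> 0"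
    unfolding H_def using pos by (intro mult_nonneg_nonneg sum_nonneg) auto
  ultimately show ?thesis
    using S unfolding \<Gamma>_def[symmetric] H_def[symmetric] by linarith
qed

context smooth_finite_sum
begin

lemma weighted_gradient_sum_bound:
  assumes perm: "\<And>t. t \<in> {1..T} \<Longrightarrow> \<pi> t permutes {1..n}"
    and \<beta>: "0 \<le> \<beta>" "\<beta> \<le> 1" and \<Theta>: "\<Theta> \<ge> 0"
    and decr: "\<And>t. t \<ge> 1 \<Longrightarrow> \<eta> (t + 1) \<le> \<eta> t" and pos: "\<And>t. t \<ge> 1 \<Longrightarrow> \<eta> t \<ge> 0"
    and small: "\<And>t. t \<ge> 1 \<Longrightarrow> (L * \<eta> t)\<^sup>2 \<le> 1 / 45"
      "\<And>t. t \<ge> 1 \<Longrightarrow> (L * \<eta> t)\<^sup>2 * (\<Theta> + 1) \<le> (1 - \<beta>) / 18"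
  shows "(1 - \<beta>) / 4 * (\<Sum>t = 1..T. \<eta> t * (norm (gradF (smg_iter n f \<beta> \<eta> w0 \<pi> (t - 1))))\<^sup>2)
    \<le> avg_obj n f w0 - avg_obj n f (smg_iter n f \<beta> \<eta> w0 \<pi> T)
      + 2 * L\<^sup>2 * \<sigma>\<^sup>2 * (\<Sum>t = 1..T. \<eta> t ^ 3)"
proof -
  define w where "w t = smg_iter n f \<beta> \<eta> w0 \<pi> t" for t
  define m where "m t = snd (smg_state n f \<beta> \<eta> w0 \<pi> t)" for t
  \<comment> \<open>The gradient norm attached to epoch \<open>t\<close> is the one at its starting point; index \<open>0\<close> stands
    for the absent epoch before the first one.\<close>
  define G where "G t = (if t = 0 then 0 else (norm (gradF (w (t - 1))))\<^sup>2)" for t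
  have w0: "w 0 = w0" and m0: "m 0 = 0" by (simp_all add: w_def smg_iter_def m_def)
  have "\<exists>u. w t = w (t - 1) - \<eta> t *\<^sub>R (\<beta> *\<^sub>R m (t - 1) + (1 - \<beta>) *\<^sub>R m t)
      \<and> (norm (gradF (w (t - 1)) - m t))\<^sup>2 \<le> u \<and> (norm (gradF (w t) - m t))\<^sup>2 \<le> u
      \<and> u \<le> (L * \<eta> t)\<^sup>2 * (\<beta> * (norm (m (t - 1)))\<^sup>2
        + 3 * (1 - \<beta>) * (u + (\<Theta> + 1) * (norm (gradF (w (t - 1))))\<^sup>2 + \<sigma>\<^sup>2))"
    if t: "t \<in> {1..T}" for t
  proof -
    obtain k where k: "t = Suc k" using t by (cases t) auto
    obtain m'' m' w' where e: "smg_epoch n f \<beta> (\<eta> t) (m k) (w k) (\<pi> t) n = (m'', m', w')"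
      by (metis prod_cases3)
    then have "w t = w'" "m t = m'"
      by (auto simp: k w_def m_def smg_iter_def case_prod_beta)
    then show ?thesis
      using epoch_error[OF perm[OF t] \<beta> e] by (metis k diff_Suc_1)
  qed
  then obtain u' where u':
    "\<And>t. t \<in> {1..T} \<Longrightarrow> w t = w (t - 1) - \<eta> t *\<^sub>R (\<beta> *\<^sub>R m (t - 1) + (1 - \<beta>) *\<^sub>R m t)"
    "\<And>t. t \<in> {1..T} \<Longrightarrow> (norm (gradF (w (t - 1)) - m t))\<^sup>2 \<le> u' t"
    "\<And>t. t \<in> {1..T} \<Longrightarrow> (norm (gradF (w t) - m t))\<^sup>2 \<le> u' t"
    "\<And>t. t \<in> {1..T} \<Longrightarrow> u' t \<le> (L * \<eta> t)\<^sup>2 * (\<beta> * (norm (m (t - 1)))\<^sup>2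
        + 3 * (1 - \<beta>) * (u' t + (\<Theta> + 1) * (norm (gradF (w (t - 1))))\<^sup>2 + \<sigma>\<^sup>2))"
    by metis
  define u where "u t = (if t = 0 then 0 else u' t)" for t
  have u_nonneg: "u t \<ge> 0" if "t \<le> T" for t
    using that order_trans[OF zero_le_power2 u'(2)[of t]] by (simp add: u_def)
  have m_le: "(norm (m t))\<^sup>2 \<le> 2 * (u t + G t)" if "t \<le> T" for t
    using that m0 u'(2)[of t] norm_add_squared_le[of "m t - gradF (w (t - 1))" "gradF (w (t - 1))"]
    by (cases "t = 0") (auto simp: u_def G_def norm_minus_commute)
  have "(1 - \<beta>) / 4 * (\<Sum>t = 1..T. \<eta> t * G t)
    \<le> avg_obj n f (w 0) - avg_obj n f (w T) + 2 * L\<^sup>2 * \<sigma>\<^sup>2 * (\<Sum>t = 1..T. \<eta> t ^ 3)"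
  proof (rule error_recursion_sum[where u = u and \<Phi> = "\<lambda>t. avg_obj n f (w t)"])
    fix t assume t: "t \<in> {1..T}"
    have G_t: "G t = (norm (gradF (w (t - 1))))\<^sup>2" and u_t: "u t = u' t"
      using t by (auto simp: G_def u_def)
    have \<eta>: "\<eta> t \<ge> 0" using pos t by auto
    have "(L * \<eta> t)\<^sup>2 \<le> 1\<^sup>2" using small(1)[of t] t by simp
    then have L\<eta>: "L * \<eta> t \<le> 1" by (rule power2_le_imp_le) simp
    \<comment> \<open>The momentum entering the first epoch is \<open>0\<close> and has squared error \<open>G 1\<close>; otherwise the
      squared error is at most that of the preceding epoch at its final point.\<close>
    have old: "(norm (gradF (w (t - 1)) - m (t - 1)))\<^sup>2 \<le> u (t - 1) + G t"
    proof (cases "t = 1")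
      case False
      then have "t - 1 \<in> {1..T}" using t by auto
      then have "(norm (gradF (w (t - 1)) - m (t - 1)))\<^sup>2 \<le> u (t - 1)"
        using u'(3) by (auto simp: u_def)
      also have "\<dots> \<le> u (t - 1) + G t" by (simp add: G_def)
      finally show ?thesis .
    qed (simp add: u_def G_def m0)
    let ?d = "\<beta> *\<^sub>R m (t - 1) + (1 - \<beta>) *\<^sub>R m t"
    have "gradF (w (t - 1)) - ?d
        = \<beta> *\<^sub>R (gradF (w (t - 1)) - m (t - 1)) + (1 - \<beta>) *\<^sub>R (gradF (w (t - 1)) - m t)"
      by (simp add: algebra_simps)
    then have "(norm (gradF (w (t - 1)) - ?d))\<^sup>2 \<le> \<beta> * (norm (gradF (w (t - 1)) - m (t - 1)))\<^sup>2
        + (1 - \<beta>) * (norm (gradF (w (t - 1)) - m t))\<^sup>2"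
      using norm_convex_squared_le[OF \<beta>] by simp
    also have "\<dots> \<le> \<beta> * (u (t - 1) + G t) + (1 - \<beta>) * u t"
      using old u'(2)[OF t] \<beta> by (intro add_mono mult_left_mono) (auto simp: u_t)
    finally have "\<eta> t / 2 * (norm (gradF (w (t - 1)) - ?d))\<^sup>2
        \<le> \<eta> t / 2 * (\<beta> * (u (t - 1) + G t) + (1 - \<beta>) * u t)"
      using \<eta> by (intro mult_left_mono) auto
    moreover have "avg_obj n f (w t) \<le> avg_obj n f (w (t - 1)) - \<eta> t / 2 * G t
        + \<eta> t / 2 * (norm (gradF (w (t - 1)) - ?d))\<^sup>2"
      using inexact_gradient_step[OF GDERIV_avg_obj gradF_lipschitz \<eta> L\<eta>]
      by (subst u'(1)[OF t]) (simp add: G_t)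
    ultimately show "avg_obj n f (w t) \<le> avg_obj n f (w (t - 1)) - (1 - \<beta>) / 2 * (\<eta> t * G t)
        + \<eta> t / 2 * (\<beta> * u (t - 1) + (1 - \<beta>) * u t)"
      by (simp add: field_simps)
    have "u t \<le> (L * \<eta> t)\<^sup>2 * (\<beta> * (norm (m (t - 1)))\<^sup>2
        + (1 - \<beta>) * (3 * (u t + (\<Theta> + 1) * G t + \<sigma>\<^sup>2)))"
      using u'(4)[OF t] unfolding u_t G_t by (simp only: mult_ac)
    also have "\<dots> \<le> (L * \<eta> t)\<^sup>2 * (1 * (2 * (u (t - 1) + G (t - 1)))
        + 1 * (3 * (u t + (\<Theta> + 1) * G t + \<sigma>\<^sup>2)))"
      using \<beta> \<Theta> t m_le[of "t - 1"] u_nonneg[of t]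
      by (intro mult_left_mono add_mono mult_mono) (auto simp: G_t)
    finally show "u t \<le> (L * \<eta> t)\<^sup>2 * (2 * (u (t - 1) + G (t - 1))
        + 3 * (u t + (\<Theta> + 1) * G t + \<sigma>\<^sup>2))" by simp
  qed (use u_nonneg decr pos \<Theta> \<beta> small in \<open>auto simp: u_def G_def\<close>)
  moreover have "(\<Sum>t = 1..T. \<eta> t * G t) = (\<Sum>t = 1..T. \<eta> t * (norm (gradF (w (t - 1))))\<^sup>2)"
    by (intro sum.cong) (auto simp: G_def)
  ultimately show ?thesis by (simp add: w0) (simp add: w_def)
qed

end

section \<open>Averaging over the random choices\<close>

lemma smg_state_cong:
  assumes "\<And>s. s \<in> {1..t} \<Longrightarrow> \<pi> s = \<pi>' s"
  shows "smg_state n f \<beta> \<eta> w0 \<pi> t = smg_state n f \<beta> \<eta> w0 \<pi>' t"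
  using assms by (induction t) auto

lemma smg_output_pmf_expectation:
  fixes g :: "'a::euclidean_space \<Rightarrow> real"
  assumes "T \<ge> 1" and pos: "\<And>t. t \<ge> 1 \<Longrightarrow> \<eta> t > 0"
  shows "measure_pmf.expectation (smg_output_pmf n f \<beta> \<eta> w0 \<pi> T) g
    = 1 / (\<Sum>t = 1..T. \<eta> t) * (\<Sum>t = 1..T. \<eta> t * g (smg_iter n f \<beta> \<eta> w0 \<pi> (t - 1)))"
proof -
  have pmf: "pmf (index_pmf \<eta> T) t = (if t \<in> {1..T} then \<eta> t / (\<Sum>s = 1..T. \<eta> s) else 0)" for t
    using assms by (intro pmf_index_pmf) auto
  have "measure_pmf.expectation (smg_output_pmf n f \<beta> \<eta> w0 \<pi> T) g
      = measure_pmf.expectation (index_pmf \<eta> T) (\<lambda>t. g (smg_iter n f \<beta> \<eta> w0 \<pi> (t - 1)))"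
    by (simp add: smg_output_pmf_def)
  also have "\<dots> = (\<Sum>t = 1..T. g (smg_iter n f \<beta> \<eta> w0 \<pi> (t - 1)) * pmf (index_pmf \<eta> T) t)"
    by (rule integral_measure_pmf_real) (auto simp: set_pmf_iff pmf split: if_splits)
  also have "\<dots> = 1 / (\<Sum>t = 1..T. \<eta> t) * (\<Sum>t = 1..T. \<eta> t * g (smg_iter n f \<beta> \<eta> w0 \<pi> (t - 1)))"
    by (simp add: pmf sum_distrib_left mult.commute)
  finally show ?thesis .
qed

text \<open>
  If \<open>X\<close> and \<open>Y\<close> take finitely many values and are independent, and the average of \<open>h q t\<close> over
  \<open>t\<close>, taken with the law of \<open>X\<close>, is at most \<open>B\<close> for every value \<open>q\<close> of \<open>Y\<close>, then so is the mean
  of \<open>h Y X\<close>.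
\<close>

lemma (in prob_space) indep_finite_expectation_le:
  fixes h :: "'q \<Rightarrow> 't \<Rightarrow> real"
  assumes fin: "finite I" "finite Q"
    and X: "\<And>\<omega>. \<omega> \<in> space M \<Longrightarrow> X \<omega> \<in> I" and Y: "\<And>\<omega>. \<omega> \<in> space M \<Longrightarrow> Y \<omega> \<in> Q"
    and indep: "indep_set \<A> \<B>"
    and XA: "\<And>t. t \<in> I \<Longrightarrow> X -` {t} \<inter> space M \<in> \<A>"
    and YB: "\<And>q. q \<in> Q \<Longrightarrow> Y -` {q} \<inter> space M \<in> \<B>"
    and avg: "\<And>q. q \<in> Q \<Longrightarrow> (\<Sum>t\<in>I. prob (X -` {t} \<inter> space M) * h q t) \<le> B"
  shows "integrable M (\<lambda>\<omega>. h (Y \<omega>) (X \<omega>))" and "expectation (\<lambda>\<omega>. h (Y \<omega>) (X \<omega>)) \<le> B"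
proof -
  let ?A = "\<lambda>t. X -` {t} \<inter> space M" and ?B = "\<lambda>q. Y -` {q} \<inter> space M"
  have sub: "\<A> \<subseteq> events" "\<B> \<subseteq> events"
    using indep unfolding indep_set_def indep_sets_def by (auto simp: UNIV_bool split: bool.splits)
  have ev: "?A t \<in> events" "?B q \<in> events" if "t \<in> I" "q \<in> Q" for t q
    using XA YB that sub by auto
  let ?g = "\<lambda>\<omega>. \<Sum>q\<in>Q. \<Sum>t\<in>I. h q t * indicator (?A t \<inter> ?B q) \<omega>"
  have eq: "h (Y \<omega>) (X \<omega>) = ?g \<omega>" if "\<omega> \<in> space M" for \<omega>
  proof -
    have "?g \<omega> = (\<Sum>q\<in>Q. \<Sum>t\<in>I. if t = X \<omega> then if q = Y \<omega> then h q t else 0 else 0)"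
      using that by (intro sum.cong) (auto simp: indicator_def)
    also have "\<dots> = h (Y \<omega>) (X \<omega>)"
      using fin X[OF that] Y[OF that] by (simp add: sum.delta)
    finally show ?thesis by simp
  qed
  have int: "integrable M (\<lambda>\<omega>. h q t * indicator (?A t \<inter> ?B q) \<omega>)" if "q \<in> Q" "t \<in> I" for q t
    using ev[OF that(2,1)] by (intro integrable_mult_right integrable_real_indicator)
      (auto simp: emeasure_eq_measure)
  have int_g: "integrable M ?g"
    by (intro Bochner_Integration.integrable_sum int)
  show "integrable M (\<lambda>\<omega>. h (Y \<omega>) (X \<omega>))"
    using int_g by (subst Bochner_Integration.integrable_cong[OF refl eq])
  have "expectation (\<lambda>\<omega>. h (Y \<omega>) (X \<omega>)) = expectation ?g"
    by (rule Bochner_Integration.integral_cong[OF refl eq])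
  also have "\<dots> = (\<Sum>q\<in>Q. \<Sum>t\<in>I. h q t * prob (?A t \<inter> ?B q))"
    using int ev by (simp add: Bochner_Integration.integral_sum Bochner_Integration.integrable_sum)
  also have "\<dots> = (\<Sum>q\<in>Q. prob (?B q) * (\<Sum>t\<in>I. prob (?A t) * h q t))"
    using XA YB unfolding sum_distrib_left
    by (intro sum.cong refl) (simp add: indep_setD[OF indep])
  also have "\<dots> \<le> (\<Sum>q\<in>Q. prob (?B q) * B)"
    by (intro sum_mono mult_left_mono avg) auto
  also have "\<dots> = prob (\<Union>q\<in>Q. ?B q) * B"
    using ev(2) XA X fin
    by (subst finite_measure_finite_Union)
      (auto simp: disjoint_family_on_def sum_distrib_right YB sub(2)[THEN subsetD])
  also have "(\<Union>q\<in>Q. ?B q) = space M"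
    using Y by auto
  finally show "expectation (\<lambda>\<omega>. h (Y \<omega>) (X \<omega>)) \<le> B"
    by (simp add: prob_space)
qed

lemma smg_output_expectation_le:
  fixes g :: "'a::euclidean_space \<Rightarrow> real" and M :: "'b measure"
  assumes rnd: "smg_randomness M n \<eta> T P \<tau>"
    and bound: "\<And>\<pi>. (\<And>t. t \<in> {1..T} \<Longrightarrow> \<pi> t permutes {1..n}) \<Longrightarrow>
      1 / (\<Sum>t = 1..T. \<eta> t) * (\<Sum>t = 1..T. \<eta> t * g (smg_iter n f \<beta> \<eta> w0 \<pi> (t - 1))) \<le> B"
  shows "integrable M (\<lambda>\<omega>. g (smg_output n f \<beta> \<eta> w0 P \<tau> \<omega>))"
    and "(\<integral>\<omega>. g (smg_output n f \<beta> \<eta> w0 P \<tau> \<omega>) \<partial>M) \<le> B"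
proof -
  define S where "S = {p. p permutes {1..n}}"
  define Y where "Y \<omega> = (\<lambda>t\<in>{1..T}. P t \<omega>)" for \<omega>
  define Q where "Q = ({1..T} \<rightarrow>\<^sub>E S)"
  define h where "h \<pi> t = g (smg_iter n f \<beta> \<eta> w0 \<pi> (t - 1))" for \<pi> t
  interpret prob_space M using rnd by (simp add: smg_randomness_def)
  have fin: "finite {1..T}" "finite Q"
    unfolding Q_def S_def by (auto intro!: finite_PiE finite_permutations)
  have \<tau>: "\<tau> \<omega> \<in> {1..T}" if "\<omega> \<in> space M" for \<omega>
    using rnd that unfolding smg_randomness_def by (auto dest!: measurable_space)
  have P: "P t \<omega> \<in> S" if "\<omega> \<in> space M" "t \<in> {1..T}" for t \<omega>
    using rnd that unfolding smg_randomness_def S_def by (auto dest!: measurable_space)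
  have Y: "Y \<omega> \<in> Q" if "\<omega> \<in> space M" for \<omega>
    using P[OF that] unfolding Y_def Q_def by auto
  have indep: "indep_set (sets (vimage_algebra (space M) \<tau> (count_space {1..T})))
      (sets (vimage_algebra (space M) Y (PiM {1..T} (\<lambda>_. count_space S))))"
    using rnd unfolding smg_randomness_def S_def Y_def by blast
  have out: "g (smg_output n f \<beta> \<eta> w0 P \<tau> \<omega>) = h (Y \<omega>) (\<tau> \<omega>)" if "\<omega> \<in> space M" for \<omega>
  proof -
    have "smg_state n f \<beta> \<eta> w0 (\<lambda>t. P t \<omega>) (\<tau> \<omega> - 1) = smg_state n f \<beta> \<eta> w0 (Y \<omega>) (\<tau> \<omega> - 1)"
      using \<tau>[OF that] by (intro smg_state_cong) (auto simp: Y_def)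
    then show ?thesis by (simp add: smg_output_def smg_iter_def h_def)
  qed
  have ev\<tau>: "\<tau> -` {t} \<inter> space M \<in> sets (vimage_algebra (space M) \<tau> (count_space {1..T}))"
    if "t \<in> {1..T}" for t
    using that by (intro in_vimage_algebra) auto
  have evY: "Y -` {q} \<inter> space M \<in> sets (vimage_algebra (space M) Y (PiM {1..T} (\<lambda>_. count_space S)))"
    if "q \<in> Q" for q
  proof (rule in_vimage_algebra)
    have "{q} = (\<Pi>\<^sub>E t\<in>{1..T}. {q t})"
      using that unfolding Q_def by (subst PiE_singleton) (auto simp: PiE_def)
    also have "\<dots> \<in> sets (PiM {1..T} (\<lambda>_. count_space S))"
      using that unfolding Q_def by (intro sets_PiM_I_finite) (auto simp: PiE_iff)
    finally show "{q} \<in> sets (PiM {1..T} (\<lambda>_. count_space S))" .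
  qed
  have avg: "(\<Sum>t = 1..T. prob (\<tau> -` {t} \<inter> space M) * h q t) \<le> B" if "q \<in> Q" for q
  proof -
    have "prob (\<tau> -` {t} \<inter> space M) = \<eta> t / (\<Sum>s = 1..T. \<eta> s)" if "t \<in> {1..T}" for t
    proof -
      have "\<tau> -` {t} \<inter> space M = {\<omega> \<in> space M. \<tau> \<omega> = t}" by auto
      then show ?thesis using rnd that unfolding smg_randomness_def by simp
    qed
    then have "(\<Sum>t = 1..T. prob (\<tau> -` {t} \<inter> space M) * h q t)
        = 1 / (\<Sum>t = 1..T. \<eta> t) * (\<Sum>t = 1..T. \<eta> t * h q t)"
      by (simp add: sum_distrib_left)
    also have "\<dots> \<le> B"
      unfolding h_def using that by (intro bound) (auto simp: Q_def S_def PiE_iff)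
    finally show ?thesis .
  qed
  note res = indep_finite_expectation_le[where h = h, OF fin \<tau> Y indep ev\<tau> evY avg]
  show "integrable M (\<lambda>\<omega>. g (smg_output n f \<beta> \<eta> w0 P \<tau> \<omega>))"
    using res(1) by (subst Bochner_Integration.integrable_cong[OF refl out])
  show "(\<integral>\<omega>. g (smg_output n f \<beta> \<eta> w0 P \<tau> \<omega>) \<partial>M) \<le> B"
    using res(2) by (subst Bochner_Integration.integral_cong[OF refl out])
qed

section \<open>The convergence bound\<close>

theorem theorem1:
  fixes f :: "nat \<Rightarrow> real ^ 'd \<Rightarrow> real"
    and F :: "real ^ 'd \<Rightarrow> real"
    and w0 :: "real ^ 'd"
    and n T :: nat
    and \<eta> :: "nat \<Rightarrow> real"
    and \<beta> L \<Theta> \<sigma> K :: real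
  assumes n: "n \<ge> 1" and T: "T \<ge> 1"
    and F: "F = avg_obj n f"
    and diff: "\<And>i w. i \<in> {1..n} \<Longrightarrow> f i differentiable (at w)"
    and bdd: "bdd_below (range F)"
    and L: "L > 0"
    and smooth: "\<And>i w w'. i \<in> {1..n} \<Longrightarrow>
        norm (gradient (f i) w - gradient (f i) w') \<le> L * norm (w - w')"
    and \<Theta>: "\<Theta> \<ge> 0" and \<sigma>: "\<sigma> \<ge> 0"
    and variance: "\<And>w. (\<Sum>i = 1..n. (norm (gradient (f i) w - gradient F w))\<^sup>2) / real n
        \<le> \<Theta> * (norm (gradient F w))\<^sup>2 + \<sigma>\<^sup>2"
    and \<beta>: "0 \<le> \<beta>" "\<beta> < 1"
    and K: "K = max (5 / 2) (9 * (5 - 3 * \<beta>) * (\<Theta> + 1) / (1 - \<beta>))"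
    and \<eta>0: "\<eta> 0 = \<eta> 1"
    and \<eta>_decr: "\<And>t. t \<ge> 1 \<Longrightarrow> \<eta> t \<ge> \<eta> (t + 1)"
    and \<eta>_pos: "\<And>t. t \<ge> 1 \<Longrightarrow> 0 < \<eta> t"
    and \<eta>_le: "\<And>t. t \<ge> 1 \<Longrightarrow> \<eta> t \<le> 1 / (L * sqrt K)"
  shows "let B = 4 * (F w0 - (INF w. F w)) / ((1 - \<beta>) * (\<Sum>t = 1..T. \<eta> t))
             + 9 * \<sigma>\<^sup>2 * L\<^sup>2 * (5 - 3 * \<beta>) / (1 - \<beta>)
               * ((\<Sum>t = 1..T. \<eta> (t - 1) ^ 3) / (\<Sum>t = 1..T. \<eta> t))
         in (\<forall>\<pi> :: nat \<Rightarrow> nat \<Rightarrow> nat. (\<forall>t\<in>{1..T}. \<pi> t permutes {1..n}) \<longrightarrow>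
               measure_pmf.expectation (smg_output_pmf n f \<beta> \<eta> w0 \<pi> T)
                   (\<lambda>w. (norm (gradient F w))\<^sup>2)
                 = 1 / (\<Sum>t = 1..T. \<eta> t)
                   * (\<Sum>t = 1..T. \<eta> t * (norm (gradient F (smg_iter n f \<beta> \<eta> w0 \<pi> (t - 1))))\<^sup>2)
               \<and> 1 / (\<Sum>t = 1..T. \<eta> t)
                   * (\<Sum>t = 1..T. \<eta> t * (norm (gradient F (smg_iter n f \<beta> \<eta> w0 \<pi> (t - 1))))\<^sup>2)
                 \<le> B)
          \<and> (\<forall>(M :: 'b measure) P \<tau>. smg_randomness M n \<eta> T P \<tau> \<longrightarrow>
               integrable M (\<lambda>\<omega>. (norm (gradient F (smg_output n f \<beta> \<eta> w0 P \<tau> \<omega>)))\<^sup>2)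
               \<and> (\<integral>\<omega>. (norm (gradient F (smg_output n f \<beta> \<eta> w0 P \<tau> \<omega>)))\<^sup>2 \<partial>M) \<le> B)"
proof -
  interpret smooth_finite_sum n f L \<Theta> \<sigma>
    using n L diff smooth variance unfolding F by unfold_locales auto
  define H where "H = (\<Sum>t = 1..T. \<eta> t)"
  define C where "C = (\<Sum>t = 1..T. \<eta> (t - 1) ^ 3)"
  define B where "B = 4 * (F w0 - (INF w. F w)) / ((1 - \<beta>) * H)
      + 9 * \<sigma>\<^sup>2 * L\<^sup>2 * (5 - 3 * \<beta>) / (1 - \<beta>) * (C / H)"
  have H: "H > 0"
    unfolding H_def using \<eta>_pos T by (intro sum_pos) auto
  have K1: "K \<ge> 9 * (5 - 3 * \<beta>) * (\<Theta> + 1) / (1 - \<beta>)" and K0: "K > 0"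
    using K by auto
  have K2: "K * (1 - \<beta>) \<ge> 9 * (5 - 3 * \<beta>) * (\<Theta> + 1)"
    using K1 \<beta> by (simp add: divide_le_eq)
  have q: "(L * \<eta> t)\<^sup>2 * K \<le> 1" if "t \<ge> 1" for t
  proof -
    have "L * \<eta> t * sqrt K \<le> 1"
      using \<eta>_le[OF that] L K0 by (simp add: field_simps)
    then have "(L * \<eta> t * sqrt K)\<^sup>2 \<le> 1\<^sup>2"
      using L K0 \<eta>_pos[OF that] by (intro power_mono) auto
    then show ?thesis using K0 by (simp add: power_mult_distrib)
  qed
  \<comment> \<open>Since \<open>5 - 3 * \<beta>\<close> is at least \<open>5 * (1 - \<beta>)\<close> and at least \<open>2\<close>, the constant \<open>K\<close> is at least
    both \<open>45\<close> and \<open>18 * (\<Theta> + 1) / (1 - \<beta>)\<close>.\<close>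
  have small1: "(L * \<eta> t)\<^sup>2 \<le> 1 / 45" if "t \<ge> 1" for t
  proof -
    have "9 * (5 - 3 * \<beta>) * 1 \<le> 9 * (5 - 3 * \<beta>) * (\<Theta> + 1)"
      using \<Theta> \<beta> by (intro mult_left_mono) auto
    moreover have "45 * (1 - \<beta>) \<le> 9 * (5 - 3 * \<beta>) * 1"
      using \<beta> by simp
    ultimately have "45 * (1 - \<beta>) \<le> K * (1 - \<beta>)"
      using K2 by linarith
    then have "45 \<le> K" by (rule mult_right_le_imp_le) (use \<beta> in simp)
    then have "(L * \<eta> t)\<^sup>2 * 45 \<le> (L * \<eta> t)\<^sup>2 * K"
      by (intro mult_left_mono) auto
    then show ?thesis using q[OF that] by simp
  qed
  have small2: "(L * \<eta> t)\<^sup>2 * (\<Theta> + 1) \<le> (1 - \<beta>) / 18" if "t \<ge> 1" for t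
  proof -
    have "18 * (\<Theta> + 1) \<le> 9 * (5 - 3 * \<beta>) * (\<Theta> + 1)"
      using \<Theta> \<beta> by (intro mult_right_mono) auto
    then have "(L * \<eta> t)\<^sup>2 * (18 * (\<Theta> + 1)) \<le> (L * \<eta> t)\<^sup>2 * (K * (1 - \<beta>))"
      using K2 by (intro mult_left_mono) auto
    also have "\<dots> \<le> 1 * (1 - \<beta>)"
      using mult_right_mono[OF q[OF that], of "1 - \<beta>"] \<beta> by (simp add: mult.assoc)
    finally show ?thesis by (simp add: algebra_simps)
  qed
  have cubes: "(\<Sum>t = 1..T. \<eta> t ^ 3) \<le> C"
    unfolding C_def
  proof (intro sum_mono power_mono)
    fix t assume t: "t \<in> {1..T}"
    show "\<eta> t \<le> \<eta> (t - 1)"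
      using \<eta>0 \<eta>_decr[of "t - 1"] t by (cases "t = 1") auto
    show "0 \<le> \<eta> t" using \<eta>_pos[of t] t by auto
  qed
  have C: "C \<ge> 0"
    using order_trans[OF sum_nonneg cubes] \<eta>_pos by (auto intro: less_imp_le)
  have bound: "1 / H * (\<Sum>t = 1..T. \<eta> t * (norm (gradient F (smg_iter n f \<beta> \<eta> w0 \<pi> (t - 1))))\<^sup>2) \<le> B"
    (is "1 / H * ?S \<le> B") if perm: "\<And>t. t \<in> {1..T} \<Longrightarrow> \<pi> t permutes {1..n}" for \<pi>
  proof -
    have "(1 - \<beta>) / 4 * ?S \<le> F w0 - F (smg_iter n f \<beta> \<eta> w0 \<pi> T) + 2 * L\<^sup>2 * \<sigma>\<^sup>2 * (\<Sum>t = 1..T. \<eta> t ^ 3)"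
      unfolding F using \<beta> \<Theta> \<eta>_decr \<eta>_pos[THEN less_imp_le] small1 small2
      by (intro weighted_gradient_sum_bound perm) auto
    also have "\<dots> \<le> F w0 - (INF w. F w) + 2 * L\<^sup>2 * \<sigma>\<^sup>2 * C"
      using cubes cINF_lower[OF bdd, of "smg_iter n f \<beta> \<eta> w0 \<pi> T"]
      by (intro add_mono diff_mono mult_left_mono) auto
    also have "2 * L\<^sup>2 * \<sigma>\<^sup>2 * C \<le> 9 / 4 * (5 - 3 * \<beta>) * (L\<^sup>2 * \<sigma>\<^sup>2 * C)"
      using mult_right_mono[of 2 "9 / 4 * (5 - 3 * \<beta>)" "L\<^sup>2 * \<sigma>\<^sup>2 * C"] \<beta> C
      by (simp add: mult.assoc)
    finally have "(1 - \<beta>) / 4 * ?S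
        \<le> F w0 - (INF w. F w) + 9 / 4 * (5 - 3 * \<beta>) * (L\<^sup>2 * \<sigma>\<^sup>2 * C)" by simp
    then have "(1 - \<beta>) / 4 * ?S * (4 / ((1 - \<beta>) * H))
        \<le> (F w0 - (INF w. F w) + 9 / 4 * (5 - 3 * \<beta>) * (L\<^sup>2 * \<sigma>\<^sup>2 * C)) * (4 / ((1 - \<beta>) * H))"
      using \<beta> H by (intro mult_right_mono) auto
    moreover have "(1 - \<beta>) / 4 * ?S * (4 / ((1 - \<beta>) * H)) = 1 / H * ?S"
      using \<beta> H by simp
    moreover have "(F w0 - (INF w. F w) + 9 / 4 * (5 - 3 * \<beta>) * (L\<^sup>2 * \<sigma>\<^sup>2 * C)) * (4 / ((1 - \<beta>) * H)) = B"
    proof -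
      have eq: "(A + 9 / 4 * e * (L\<^sup>2 * \<sigma>\<^sup>2 * C)) * (4 / (b * H))
          = 4 * A / (b * H) + 9 * \<sigma>\<^sup>2 * L\<^sup>2 * e / b * (C / H)" if "b > 0" for A e b
        using that H by (simp add: field_simps)
      show ?thesis unfolding B_def by (rule eq) (use \<beta> in simp)
    qed
    ultimately show ?thesis by simp
  qed
  show ?thesis
    unfolding Let_def H_def[symmetric] C_def[symmetric] B_def[symmetric]
  proof (intro conjI allI impI)
    fix \<pi> :: "nat \<Rightarrow> nat \<Rightarrow> nat" assume "\<forall>t\<in>{1..T}. \<pi> t permutes {1..n}"
    then show "1 / H * (\<Sum>t = 1..T. \<eta> t * (norm (gradient F (smg_iter n f \<beta> \<eta> w0 \<pi> (t - 1))))\<^sup>2) \<le> B"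
      by (intro bound) auto
    show "measure_pmf.expectation (smg_output_pmf n f \<beta> \<eta> w0 \<pi> T) (\<lambda>w. (norm (gradient F w))\<^sup>2)
        = 1 / H * (\<Sum>t = 1..T. \<eta> t * (norm (gradient F (smg_iter n f \<beta> \<eta> w0 \<pi> (t - 1))))\<^sup>2)"
      unfolding H_def using T \<eta>_pos by (intro smg_output_pmf_expectation) auto
  next
    fix M :: "'b measure" and P \<tau> assume rnd: "smg_randomness M n \<eta> T P \<tau>"
    note res = smg_output_expectation_le[OF rnd, where g = "\<lambda>w. (norm (gradient F w))\<^sup>2",
        OF bound[unfolded H_def]]
    show "integrable M (\<lambda>\<omega>. (norm (gradient F (smg_output n f \<beta> \<eta> w0 P \<tau> \<omega>)))\<^sup>2)"
      by (rule res(1))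
    show "(\<integral>\<omega>. (norm (gradient F (smg_output n f \<beta> \<eta> w0 P \<tau> \<omega>)))\<^sup>2 \<partial>M) \<le> B"
      by (rule res(2))
  qed
qed

end
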